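(* Let $f:\mathbb{R}^N\to\mathbb{R}$ be continuously differentiable and bounded below (there is a constant $f_{\rm low}$ with $f(x)\ge f_{\rm low}$ for all $x$), and let its gradient be block Lipschitz continuous with respect to the partition $\{1,\dots,N\}=\bigcup_{\ell=1}^d b_\ell$ with block constants $L_\ell\ge 0$. Let $(x_k)$, $(w_k)$, $(\ell_k)$ be generated by the bAdag algorithm applied to $\min_{x\in\mathbb{R}^N} f(x)$. Then, for all $j\ge 0$: (GS/C) if the blocks are selected by the Gauss-Southwell rule or the cyclic rule, $$f(x_{j+1})\le f(x_j)-\sum_{i=1}^N\frac{(g_{i,j}^{(\ell_j)})^2}{w_{i,j}}+\frac{L_{\ell_j}}{2}\sum_{i=1}^N\frac{(g_{i,j}^{(\ell_j)})^2}{w_{i,j}^2};$$ (UR) if the blocks are selected uniformly at random, $$\mathbb{E}_j\left[f(x_{j+1})\right]\le f(x_j)-\mathbb{E}_j\left[\sum_{i=1}^N\frac{(g_{i,j}^{(\ell_j)})^2}{w_{i,j}}\right]+\frac12\,\mathbb{E}_j\left[L_{\ell_j}\sum_{i=1}^N\frac{(g_{i,j}^{(\ell_j)})^2}{w_{i,j}^2}\right].$$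
   Context: Notation. $\{1,\dots,N\}=\bigcup_{\ell=1}^d b_\ell$ is a fixed partition into (nonempty, pairwise disjoint) blocks. $g=\nabla f$, $g_k=g(x_k)$, and $g_{i,k}$ is its $i$-th component. For a vector $u\in\mathbb{R}^N$, $u^{(\ell)}$ is the vector equal to $u$ on the components in $b_\ell$ and zero elsewhere; so $g_{i,k}^{(\ell)}=g_{i,k}$ if $i\in b_\ell$ and $0$ otherwise. $\|\cdot\|$ is the Euclidean norm. Block Lipschitz continuity: for every $\ell=1,\dots,d$, $\|g^{(\ell)}(x)-g^{(\ell)}(x+s^{(\ell)})\|\le L_\ell\|s^{(\ell)}\|$ for all $x\in\mathbb{R}^N$ and all $s^{(\ell)}\in\mathbb{R}^N$ with support contained in $b_\ell$. bAdag algorithm. Given $x_0\in\mathbb{R}^N$, $\varsigma\in(0,1)$, and $w_{i,-1}=\sqrt{\varsigma}$ for $i=1,\dots,N$. For $k=0,1,2,\dots$: select a block $b_{\ell_k}$; set $w_{i,k}=\sqrt{w_{i,k-1}^2+g_{i,k}^2}$ for $i\in b_{\ell_k}$ and $w_{i,k}=w_{i,k-1}$ otherwise; set $s_{i,k}=-g_{i,k}/w_{i,k}$ for $i\in b_{\ell_k}$ and $s_{i,k}=0$ otherwise; set $x_{k+1}=x_k+s_k$. Block selection rules. GS (Gauss-Southwell): $\ell_k$ is such that $\|g_k^{(\ell_k)}\|=\max_{\ell=1,\dots,d}\|g_k^{(\ell)}\|$. C (cyclic): blocks are picked in cyclic order, so every $d$ iterations each block is updated exactly once, i.e. $\ell_k=(k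 \bmod d)+1$. UR: $\ell_k$ is drawn uniformly from $\{1,\dots,d\}$, independently of the past. In the UR case $\mathbb{E}_j[\cdot]$ denotes expectation conditional on the history of the algorithm up to the computation of $x_j$ (i.e. on $\ell_0,\dots,\ell_{j-1}$), before $\ell_j$ is drawn. *)

theory Defs
  imports "HOL-Analysis.Analysis" "HOL-Probability.Probability"
begin

text \<open>Coordinates are indexed by a finite type \<open>'n\<close>, so that \<open>real ^ 'n\<close> is the Euclidean space
  of dimension \<open>N = CARD('n)\<close>. Blocks are \<open>b 1, \<dots>, b d\<close>.\<close>

definition block_partition :: "nat \<Rightarrow> (nat \<Rightarrow> 'n::finite set) \<Rightarrow> bool" where
  "block_partition d b \<longleftrightarrow>
     (\<forall>l\<in>{1..d}. b l \<noteq> {}) \<and> disjoint_family_on b {1..d} \<and> (\<Union>l\<in>{1..d}. b l) = UNIV"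

definition restrict_vec :: "'n::finite set \<Rightarrow> real ^ 'n \<Rightarrow> real ^ 'n" where
  "restrict_vec B u = (\<chi> i. if i \<in> B then u $ i else 0)"

definition block_lipschitz ::
    "nat \<Rightarrow> (nat \<Rightarrow> 'n::finite set) \<Rightarrow> (nat \<Rightarrow> real) \<Rightarrow> (real ^ 'n \<Rightarrow> real ^ 'n) \<Rightarrow> bool" where
  "block_lipschitz d b L g \<longleftrightarrow>
     (\<forall>l\<in>{1..d}. \<forall>x s. (\<forall>i. i \<notin> b l \<longrightarrow> s $ i = 0) \<longrightarrow>
        norm (restrict_vec (b l) (g x) - restrict_vec (b l) (g (x + s))) \<le> L l * norm s)"

text \<open>\<open>prev_weight \<sigma> w k\<close> is the weight vector with index \<open>k - 1\<close>, which for \<open>k = 0\<close> is the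
  initial weight vector with all components \<open>sqrt \<sigma>\<close>.\<close>

definition prev_weight :: "real \<Rightarrow> (nat \<Rightarrow> real ^ 'n::finite) \<Rightarrow> nat \<Rightarrow> real ^ 'n" where
  "prev_weight \<sigma> w k = (case k of 0 \<Rightarrow> (\<chi> i. sqrt \<sigma>) | Suc m \<Rightarrow> w m)"

text \<open>\<open>bAdag d b g \<sigma> x0 l x w\<close>: the sequences \<open>l\<close>, \<open>x\<close>, \<open>w\<close> of selected blocks, iterates and
  weights form a run of the algorithm; the selection rule is left open.\<close>

definition bAdag ::
    "nat \<Rightarrow> (nat \<Rightarrow> 'n::finite set) \<Rightarrow> (real ^ 'n \<Rightarrow> real ^ 'n) \<Rightarrow> real \<Rightarrow> real ^ 'n \<Rightarrow>
     (nat \<Rightarrow> nat) \<Rightarrow> (nat \<Rightarrow> real ^ 'n) \<Rightarrow> (nat \<Rightarrow> real ^ 'n) \<Rightarrow> bool" where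
  "bAdag d b g \<sigma> x0 l x w \<longleftrightarrow>
     x 0 = x0 \<and>
     (\<forall>k. l k \<in> {1..d} \<and>
          w k = (\<chi> i. if i \<in> b (l k)
                      then sqrt ((prev_weight \<sigma> w k $ i)\<^sup>2 + (g (x k) $ i)\<^sup>2)
                      else prev_weight \<sigma> w k $ i) \<and>
          x (Suc k) = x k + (\<chi> i. if i \<in> b (l k) then - (g (x k) $ i) / w k $ i else 0))"

definition gauss_southwell ::
    "nat \<Rightarrow> (nat \<Rightarrow> 'n::finite set) \<Rightarrow> (real ^ 'n \<Rightarrow> real ^ 'n) \<Rightarrow>
     (nat \<Rightarrow> nat) \<Rightarrow> (nat \<Rightarrow> real ^ 'n) \<Rightarrow> bool" where
  "gauss_southwell d b g l x \<longleftrightarrow>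
     (\<forall>k. norm (restrict_vec (b (l k)) (g (x k))) =
          Max ((\<lambda>m. norm (restrict_vec (b m) (g (x k)))) ` {1..d}))"

definition cyclic_rule :: "nat \<Rightarrow> (nat \<Rightarrow> nat) \<Rightarrow> bool" where
  "cyclic_rule d l \<longleftrightarrow> (\<forall>k. l k = k mod d + 1)"

text \<open>The history up to the computation of the \<open>j\<close>-th iterate is the sigma-algebra generated by
  \<open>l 0, \<dots>, l (j - 1)\<close>; the starting point is deterministic, so it is trivial for \<open>j = 0\<close>.\<close>

definition history :: "'w measure \<Rightarrow> nat \<Rightarrow> (nat \<Rightarrow> 'w \<Rightarrow> nat) \<Rightarrow> nat \<Rightarrow> 'w measure" where
  "history M d l j = sigma (space M) {l k -` A \<inter> space M | k A. k < j \<and> A \<subseteq> {1..d}}"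

definition uniform_random_rule :: "'w measure \<Rightarrow> nat \<Rightarrow> (nat \<Rightarrow> 'w \<Rightarrow> nat) \<Rightarrow> bool" where
  "uniform_random_rule M d l \<longleftrightarrow>
     (\<forall>k. l k \<in> measurable M (count_space {1..d}) \<and>
          distr M (count_space {1..d}) (l k) = uniform_count_measure {1..d} \<and>
          prob_space.indep_set M {l k -` A \<inter> space M | A. A \<subseteq> {1..d}} (sets (history M d l k)))"

end

theory Submission
  imports Defs
begin

text \<open>Each step is a scaled gradient step inside one block, so the descent lemma, applied with the
  Lipschitz constant of that block, gives the estimate along every run, whatever the selection rule.
  In the random case the state at time \<open>j\<close> takes finitely many values and is determined by the
  history, so all random variables involved are integrable, \<open>f (x j)\<close> passes through the conditional
  expectation, and the pathwise estimate only has to be averaged.\<close>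

text \<open>Compare \<open>f\<close> along the segment from \<open>x\<close> to \<open>x + s\<close>
  with its quadratic model: the derivative of the difference is nonpositive, so no integral of the
  gradient is formed. A block constant suffices because \<open>s\<close> lives in block
  \<open>m\<close> and its inner products see only the gradient components there.\<close>

lemma block_descent:
  fixes f :: "real ^ 'n::finite \<Rightarrow> real"
  assumes gradient: "\<And>y. GDERIV f y :> g y"
    and lipschitz: "block_lipschitz d b L g" and m: "m \<in> {1..d}"
    and supp: "\<And>i. i \<notin> b m \<Longrightarrow> s $ i = 0"
  shows "f (x + s) \<le> f x + g x \<bullet> s + L m / 2 * (norm s)\<^sup>2"
proof -
  \<comment> \<open>Chosen so that \<open>\<phi> 0 = f x\<close> and
    \<open>\<phi> 1 \<le> \<phi> 0\<close> rearranges to the claim.\<close>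
  define \<phi> where "\<phi> t = f (x + t *\<^sub>R s) - t * (g x \<bullet> s) - L m / 2 * t\<^sup>2 * (norm s)\<^sup>2" for t
  have "\<phi> 1 \<le> \<phi> 0"
  proof (rule DERIV_nonpos_imp_nonincreasing[where f=\<phi>])
    fix t :: real assume t: "0 \<le> t"
    define D where "D = restrict_vec (b m) (g x) - restrict_vec (b m) (g (x + t *\<^sub>R s))"
    have "(f has_derivative (\<lambda>h. h \<bullet> g (x + t *\<^sub>R s))) (at (x + t *\<^sub>R s))"
      using gradient by (simp add: gderiv_def)
    then have "((\<lambda>t. f (x + t *\<^sub>R s)) has_derivative (\<lambda>h. (h *\<^sub>R s) \<bullet> g (x + t *\<^sub>R s))) (at t)"
      by (rule has_derivative_compose[rotated]) (auto intro!: derivative_eq_intros)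
    then have "DERIV (\<lambda>t. f (x + t *\<^sub>R s)) t :> s \<bullet> g (x + t *\<^sub>R s)"
      by (simp add: has_field_derivative_def mult_commute_abs)
    then have "DERIV \<phi> t :> s \<bullet> g (x + t *\<^sub>R s) - g x \<bullet> s - L m * t * (norm s)\<^sup>2"
      unfolding \<phi>_def by (auto intro!: derivative_eq_intros)
    moreover have "s \<bullet> g (x + t *\<^sub>R s) - g x \<bullet> s = - (D \<bullet> s)"
    proof -
      \<comment> \<open>Off the block \<open>s\<close> vanishes, so removing the restriction in
        \<open>D\<close> changes no term of the sum.\<close>
      have "D \<bullet> s = (g x - g (x + t *\<^sub>R s)) \<bullet> s"
        unfolding inner_vec_def D_def restrict_vec_def by (intro sum.cong) (auto simp: supp)
      then show ?thesis by (simp add: inner_diff_left inner_commute[of s])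
    qed
    moreover have "- (D \<bullet> s) \<le> L m * t * (norm s)\<^sup>2"
    proof -
      \<comment> \<open>The scaled vector \<open>t *\<^sub>R s\<close> still has its support in
        \<open>b m\<close>, which is what the block Lipschitz condition asks for.\<close>
      have "norm D \<le> L m * norm (t *\<^sub>R s)"
        using lipschitz m unfolding block_lipschitz_def D_def
        by (metis supp vector_scaleR_component scaleR_zero_right)
      then have "norm D * norm s \<le> L m * t * norm s * norm s"
        using t by (intro mult_right_mono) (auto simp: mult.assoc)
      moreover have "\<bar>D \<bullet> s\<bar> \<le> norm D * norm s"
        by (rule Cauchy_Schwarz_ineq2)
      ultimately show ?thesis by (simp add: power2_eq_square mult.assoc)
    qed
    ultimately show "\<exists>y. DERIV \<phi> t :> y \<and> y \<le> 0" by auto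
  qed simp
  then show ?thesis by (simp add: \<phi>_def)
qed

text \<open>For the algorithm's step \<open>s\<close>, the linear term of the block descent estimate
  is minus the first sum, and \<open>(norm s)\<^sup>2\<close> is the second sum.\<close>

lemma bAdag_descent:
  fixes f :: "real ^ 'n::finite \<Rightarrow> real"
  assumes gradient: "\<And>y. GDERIV f y :> g y"
    and lipschitz: "block_lipschitz d b L g"
    and run: "bAdag d b g \<sigma> x0 l x w"
  shows "f (x (Suc j)) \<le> f (x j)
           - (\<Sum>i\<in>UNIV. (restrict_vec (b (l j)) (g (x j)) $ i)\<^sup>2 / w j $ i)
           + L (l j) / 2 * (\<Sum>i\<in>UNIV. (restrict_vec (b (l j)) (g (x j)) $ i)\<^sup>2 / (w j $ i)\<^sup>2)"
proof -
  define s where "s = (\<chi> i. if i \<in> b (l j) then - (g (x j) $ i) / w j $ i else 0)"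
  have step: "x (Suc j) = x j + s" and block: "l j \<in> {1..d}"
    using run by (auto simp: bAdag_def s_def)
  \<comment> \<open>This identity and the next hold term by term, even at a zero weight, where
    division returns 0.\<close>
  have "g (x j) \<bullet> s = - (\<Sum>i\<in>UNIV. (restrict_vec (b (l j)) (g (x j)) $ i)\<^sup>2 / w j $ i)"
    unfolding inner_vec_def s_def restrict_vec_def sum_negf[symmetric]
    by (intro sum.cong) (auto simp: power2_eq_square)
  moreover have "(norm s)\<^sup>2 = (\<Sum>i\<in>UNIV. (restrict_vec (b (l j)) (g (x j)) $ i)\<^sup>2 / (w j $ i)\<^sup>2)"
    unfolding power2_norm_eq_inner inner_vec_def s_def restrict_vec_def
    by (intro sum.cong) (auto simp: power2_eq_square)
  ultimately show ?thesis
    using block_descent[OF gradient lipschitz block, of s "x j"] unfolding step by (simp add: s_def)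
qed

lemma space_history [simp]: "space (history M d l j) = space M"
  unfolding history_def by (subst space_measure_of) auto

lemma sets_history:
  "sets (history M d l j)
     = sigma_sets (space M) {l k -` A \<inter> space M | k A. k < j \<and> A \<subseteq> {1..d}}"
  unfolding history_def by (subst sets_measure_of) auto

lemma sets_history_mono: "i \<le> j \<Longrightarrow> sets (history M d l i) \<subseteq> sets (history M d l j)"
  unfolding sets_history by (intro sigma_sets_mono') force

lemma subalgebra_history:
  assumes "\<And>k. l k \<in> measurable M (count_space {1..d})"
  shows "subalgebra M (history M d l j)"
proof -
  have "l k -` A \<inter> space M \<in> sets M" if "A \<subseteq> {1..d}" for k A
    using measurable_sets[OF assms] that by simp
  then have "{l k -` A \<inter> space M | k A. k < j \<and> A \<subseteq> {1..d}} \<subseteq> sets M"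
    by blast
  then show ?thesis
    unfolding subalgebra_def sets_history by (simp add: sets.sigma_sets_subset)
qed

text \<open>The range is finite, and for \<open>k < j\<close> every fibre is one of the generators
  of the history.\<close>

lemma simple_function_history:
  assumes l: "l k \<in> measurable M (count_space {1..d})" and "k < j"
  shows "simple_function (history M d l j) (l k)"
proof -
  have range: "l k ` space M \<subseteq> {1..d}"
    using measurable_space[OF l] by auto
  then have "l k -` {y} \<inter> space M \<in> sets (history M d l j)" if "y \<in> l k ` space M" for y
    unfolding sets_history using that \<open>k < j\<close> by (intro sigma_sets.Basic) blast
  then show ?thesis
    unfolding simple_function_def using finite_subset[OF range] by simp
qed

text \<open>A function with finitely many values is bounded. This yields integrability of
  \<open>f (x k)\<close> without a growth condition on \<open>f\<close>.\<close>

lemma (in finite_measure) integrable_simple_function: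
  fixes h :: "'a \<Rightarrow> real"
  assumes h: "simple_function M h"
  shows "integrable M h"
proof -
  have "finite ((\<lambda>x. \<bar>h x\<bar>) ` space M)"
    using simple_functionD(1)[OF h] by (metis finite_imageI image_image)
  then have "\<bar>h x\<bar> \<le> Max ((\<lambda>x. \<bar>h x\<bar>) ` space M)" if "x \<in> space M" for x
    using that by simp
  then show ?thesis
    by (intro integrable_const_bound[OF AE_I2] borel_measurable_simple_function h) simp
qed

text \<open>The iterate paired with the preceding weight is a state whose successor depends only on
  it and on the drawn block. Simple functions are stable under composition with arbitrary maps, so
  induction applies. The weight has index \<open>j - 1\<close> because \<open>w j\<close> already
  depends on \<open>l j\<close>, which lies outside the history at \<open>j\<close>.\<close>

lemma simple_function_bAdag_state:
  fixes x w :: "nat \<Rightarrow> 'w \<Rightarrow> real ^ 'n::finite"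
  assumes l: "\<And>k. l k \<in> measurable M (count_space {1..d})"
    and run: "\<And>\<omega>. \<omega> \<in> space M \<Longrightarrow>
      bAdag d b g \<sigma> x0 (\<lambda>k. l k \<omega>) (\<lambda>k. x k \<omega>) (\<lambda>k. w k \<omega>)"
  shows "simple_function (history M d l j) (\<lambda>\<omega>. (x j \<omega>, prev_weight \<sigma> (\<lambda>k. w k \<omega>) j))"
proof (induction j)
  case 0
  have "x 0 \<omega> = x0" if "\<omega> \<in> space M" for \<omega>
    using run[OF that] by (simp add: bAdag_def)
  then have "simple_function (history M d l 0) (\<lambda>\<omega>. (x 0 \<omega>, prev_weight \<sigma> (\<lambda>k. w k \<omega>) 0))
      \<longleftrightarrow> simple_function (history M d l 0) (\<lambda>_. (x0, (\<chi> i. sqrt \<sigma>) :: real ^ 'n))"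
    by (intro simple_function_cong) (simp add: prev_weight_def)
  then show ?case by simp
next
  case (Suc j)
  \<comment> \<open>\<open>W\<close> and \<open>X\<close> are one update as deterministic maps of
    block \<open>m\<close>, iterate \<open>y\<close> and preceding weight \<open>u\<close>;
    \<open>X\<close> divides by the updated weight.\<close>
  define W where "W m y u = (\<chi> i. if i \<in> b m then sqrt ((u $ i)\<^sup>2 + (g y $ i)\<^sup>2) else u $ i)"
    for m :: nat and y u :: "real ^ 'n"
  define X where "X m y u = y + (\<chi> i. if i \<in> b m then - (g y $ i) / W m y u $ i else 0)"
    for m :: nat and y u :: "real ^ 'n"
  have "simple_function (history M d l (Suc j)) (l j)"
    by (rule simple_function_history[OF l]) simp
  moreover have "simple_function (history M d l (Suc j))
      (\<lambda>\<omega>. (x j \<omega>, prev_weight \<sigma> (\<lambda>k. w k \<omega>) j))"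
    \<comment> \<open>The old state stays simple for the larger history, in which \<open>l j\<close>
      is simple too.\<close>
    using Suc sets_history_mono[of j "Suc j" M d l] by (rule simple_function_subalgebra) auto
  ultimately have "simple_function (history M d l (Suc j))
      (\<lambda>\<omega>. (\<lambda>m (y, u). (X m y u, W m y u)) (l j \<omega>) (x j \<omega>, prev_weight \<sigma> (\<lambda>k. w k \<omega>) j))"
    by (rule simple_function_compose2)
  moreover have "(x (Suc j) \<omega>, prev_weight \<sigma> (\<lambda>k. w k \<omega>) (Suc j))
      = (\<lambda>m (y, u). (X m y u, W m y u)) (l j \<omega>) (x j \<omega>, prev_weight \<sigma> (\<lambda>k. w k \<omega>) j)"
    if "\<omega> \<in> space M" for \<omega>
  proof -
    have w: "w j \<omega> = W (l j \<omega>) (x j \<omega>) (prev_weight \<sigma> (\<lambda>k. w k \<omega>) j)"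
      using run[OF that] unfolding bAdag_def W_def by blast
    have "x (Suc j) \<omega> = X (l j \<omega>) (x j \<omega>) (prev_weight \<sigma> (\<lambda>k. w k \<omega>) j)"
      using run[OF that] unfolding bAdag_def X_def w[symmetric] by blast
    then show ?thesis using w by (simp add: prev_weight_def)
  qed
  ultimately show ?case
    using simple_function_cong[of "history M d l (Suc j)"
        "\<lambda>\<omega>. (x (Suc j) \<omega>, prev_weight \<sigma> (\<lambda>k. w k \<omega>) (Suc j))"] by simp
qed

theorem lemma4p1:
  fixes f :: "real ^ 'n::finite \<Rightarrow> real"
    and g :: "real ^ 'n \<Rightarrow> real ^ 'n"
    and d :: nat
    and b :: "nat \<Rightarrow> 'n set"
    and L :: "nat \<Rightarrow> real"
    and \<sigma> :: real
    and x0 :: "real ^ 'n"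
  assumes partition: "block_partition d b"
    and gradient: "\<And>y. GDERIV f y :> g y"
    and gradient_continuous: "continuous_on UNIV g"
    and bounded_below: "\<exists>f_low. \<forall>y. f y \<ge> f_low"
    and L_nonneg: "\<And>m. m \<in> {1..d} \<Longrightarrow> L m \<ge> 0"
    and lipschitz: "block_lipschitz d b L g"
    and \<sigma>: "0 < \<sigma>" "\<sigma> < 1"
  shows
    "(\<forall>l x w.
        bAdag d b g \<sigma> x0 l x w \<and> (gauss_southwell d b g l x \<or> cyclic_rule d l) \<longrightarrow>
        (\<forall>j. f (x (Suc j)) \<le> f (x j)
               - (\<Sum>i\<in>UNIV. (restrict_vec (b (l j)) (g (x j)) $ i)\<^sup>2 / w j $ i)
               + L (l j) / 2 *
                 (\<Sum>i\<in>UNIV. (restrict_vec (b (l j)) (g (x j)) $ i)\<^sup>2 / (w j $ i)\<^sup>2)))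
     \<and>
     (\<forall>(M :: 'w measure) l x w.
        prob_space M \<and> uniform_random_rule M d l \<and>
        (\<forall>\<omega>\<in>space M. bAdag d b g \<sigma> x0 (\<lambda>k. l k \<omega>) (\<lambda>k. x k \<omega>) (\<lambda>k. w k \<omega>)) \<longrightarrow>
        (\<forall>j. AE \<omega> in M.
           real_cond_exp M (history M d l j) (\<lambda>\<omega>. f (x (Suc j) \<omega>)) \<omega>
             \<le> f (x j \<omega>)
               - real_cond_exp M (history M d l j)
                   (\<lambda>\<omega>. \<Sum>i\<in>UNIV. (restrict_vec (b (l j \<omega>)) (g (x j \<omega>)) $ i)\<^sup>2 / w j \<omega> $ i) \<omega>
               + 1 / 2 * real_cond_exp M (history M d l j)
                   (\<lambda>\<omega>. L (l j \<omega>) *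
                     (\<Sum>i\<in>UNIV. (restrict_vec (b (l j \<omega>)) (g (x j \<omega>)) $ i)\<^sup>2 / (w j \<omega> $ i)\<^sup>2)) \<omega>))"
proof (intro conjI allI impI)
  fix l :: "nat \<Rightarrow> nat" and x w j
  assume "bAdag d b g \<sigma> x0 l x w \<and> (gauss_southwell d b g l x \<or> cyclic_rule d l)"
  then show "f (x (Suc j)) \<le> f (x j)
               - (\<Sum>i\<in>UNIV. (restrict_vec (b (l j)) (g (x j)) $ i)\<^sup>2 / w j $ i)
               + L (l j) / 2 *
                 (\<Sum>i\<in>UNIV. (restrict_vec (b (l j)) (g (x j)) $ i)\<^sup>2 / (w j $ i)\<^sup>2)"
    using bAdag_descent[OF gradient lipschitz] by blast
next
  fix M :: "'w measure" and l :: "nat \<Rightarrow> 'w \<Rightarrow> nat" and x w :: "nat \<Rightarrow> 'w \<Rightarrow> real ^ 'n" and j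
  assume *: "prob_space M \<and> uniform_random_rule M d l \<and>
    (\<forall>\<omega>\<in>space M. bAdag d b g \<sigma> x0 (\<lambda>k. l k \<omega>) (\<lambda>k. x k \<omega>) (\<lambda>k. w k \<omega>))"
  then interpret prob_space M by simp
  have l: "l k \<in> measurable M (count_space {1..d})" for k
    using * by (auto simp: uniform_random_rule_def)
  have run: "bAdag d b g \<sigma> x0 (\<lambda>k. l k \<omega>) (\<lambda>k. x k \<omega>) (\<lambda>k. w k \<omega>)" if "\<omega> \<in> space M" for \<omega>
    using * that by blast
  let ?H = "history M d l"
  interpret finite_measure_subalgebra M "?H j"
    by unfold_locales (rule subalgebra_history[of l, OF l])
  \<comment> \<open>Integrability is a statement about \<open>M\<close>, so simplicity is carried
    over from the histories.\<close>
  have to_M: "simple_function (?H k) h \<Longrightarrow> simple_function M h" for k and h :: "'w \<Rightarrow> 'z"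
    using subalgebra_history[of l, OF l, of k] simple_function_subalgebra[of "?H k" h M]
    by (simp add: subalgebra_def)
  note state = simple_function_bAdag_state[where l=l and x=x and w=w, OF l run]
  have x_H: "simple_function (?H k) (x k)" for k
    using simple_function_compose1[OF state, of k fst] by simp
  \<comment> \<open>The index shifts by one: \<open>w k\<close> is the weight part of the state at
    \<open>Suc k\<close>.\<close>
  have w_H: "simple_function (?H (Suc k)) (w k)" for k
    using simple_function_compose1[OF state, of "Suc k" snd] by (simp add: prev_weight_def)
  \<comment> \<open>The draw \<open>l j\<close> enters the history only at
    \<open>Suc j\<close>.\<close>
  have l_M: "simple_function M (l j)"
    by (rule to_M[OF simple_function_history[OF l, of j "Suc j"]]) simp
  note x_M = to_M[OF x_H] and w_M = to_M[OF w_H]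
  have lx_M: "simple_function M (\<lambda>\<omega>. restrict_vec (b (l j \<omega>)) (g (x j \<omega>)) $ i)" for i
    using simple_function_compose2[OF l_M x_M, of "\<lambda>m y. restrict_vec (b m) (g y) $ i"] .
  define A where "A \<omega> = (\<Sum>i\<in>UNIV. (restrict_vec (b (l j \<omega>)) (g (x j \<omega>)) $ i)\<^sup>2 / w j \<omega> $ i)" for \<omega>
  define B where "B \<omega> = L (l j \<omega>) *
    (\<Sum>i\<in>UNIV. (restrict_vec (b (l j \<omega>)) (g (x j \<omega>)) $ i)\<^sup>2 / (w j \<omega> $ i)\<^sup>2)" for \<omega>
  have summand:
    "simple_function M (\<lambda>\<omega>. (restrict_vec (b (l j \<omega>)) (g (x j \<omega>)) $ i)\<^sup>2 / w j \<omega> $ i)"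
    "simple_function M (\<lambda>\<omega>. (restrict_vec (b (l j \<omega>)) (g (x j \<omega>)) $ i)\<^sup>2 / (w j \<omega> $ i)\<^sup>2)" for i
    using simple_function_compose2[OF lx_M[of i] w_M[of j], of "\<lambda>r u. r\<^sup>2 / u $ i"]
      simple_function_compose2[OF lx_M[of i] w_M[of j], of "\<lambda>r u. r\<^sup>2 / (u $ i)\<^sup>2"] .
  have int_f: "integrable M (\<lambda>\<omega>. f (x k \<omega>))" for k
    by (rule integrable_simple_function[OF simple_function_compose1[OF x_M]])
  have int_A: "integrable M A"
    unfolding A_def by (rule integrable_simple_function[OF simple_function_sum[OF summand(1)]])
  have int_B: "integrable M B"
    unfolding B_def
    by (rule integrable_simple_function[OF simple_function_mult[OF
        simple_function_compose1[OF l_M] simple_function_sum[OF summand(2)]]])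
  \<comment> \<open>The factor \<open>L (l j \<omega>)\<close> stays inside \<open>B\<close>, since
    it varies with the draw; only \<open>1 / 2\<close> is pulled out.\<close>
  have pathwise: "f (x (Suc j) \<omega>) \<le> f (x j \<omega>) - A \<omega> + 1 / 2 * B \<omega>" if "\<omega> \<in> space M" for \<omega>
    using bAdag_descent[OF gradient lipschitz run[OF that], of j] by (simp add: A_def B_def)
  \<comment> \<open>\<open>x j\<close> is simple for \<open>?H j\<close> itself, so
    \<open>f (x j)\<close> is its own conditional expectation.\<close>
  have fx: "AE \<omega> in M. real_cond_exp M (?H j) (\<lambda>\<omega>. f (x j \<omega>)) \<omega> = f (x j \<omega>)"
    by (rule real_cond_exp_F_meas[OF int_f
        borel_measurable_simple_function[OF simple_function_compose1[OF x_H]]])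
  have mono: "AE \<omega> in M. real_cond_exp M (?H j) (\<lambda>\<omega>. f (x (Suc j) \<omega>)) \<omega>
      \<le> real_cond_exp M (?H j) (\<lambda>\<omega>. f (x j \<omega>) - A \<omega> + 1 / 2 * B \<omega>) \<omega>"
    using int_f int_A int_B by (intro real_cond_exp_mono AE_I2 pathwise) auto
  have add: "AE \<omega> in M. real_cond_exp M (?H j) (\<lambda>\<omega>. f (x j \<omega>) - A \<omega> + 1 / 2 * B \<omega>) \<omega>
      = real_cond_exp M (?H j) (\<lambda>\<omega>. f (x j \<omega>) - A \<omega>) \<omega>
        + real_cond_exp M (?H j) (\<lambda>\<omega>. 1 / 2 * B \<omega>) \<omega>"
    using int_f int_A int_B by (intro real_cond_exp_add) auto
  show "AE \<omega> in M.
           real_cond_exp M (history M d l j) (\<lambda>\<omega>. f (x (Suc j) \<omega>)) \<omega>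
             \<le> f (x j \<omega>)
               - real_cond_exp M (history M d l j)
                   (\<lambda>\<omega>. \<Sum>i\<in>UNIV. (restrict_vec (b (l j \<omega>)) (g (x j \<omega>)) $ i)\<^sup>2 / w j \<omega> $ i) \<omega>
               + 1 / 2 * real_cond_exp M (history M d l j)
                   (\<lambda>\<omega>. L (l j \<omega>) *
                     (\<Sum>i\<in>UNIV. (restrict_vec (b (l j \<omega>)) (g (x j \<omega>)) $ i)\<^sup>2 / (w j \<omega> $ i)\<^sup>2)) \<omega>"
    unfolding A_def[symmetric] B_def[symmetric]
    \<comment> \<open>Monotonicity averages the pathwise bound, and linearity splits its right-hand
      side; each holds almost everywhere, so the pieces are combined pointwise.\<close>
    using fx mono add real_cond_exp_diff[OF int_f[of j] int_A] real_cond_exp_cmult[OF int_B, of "1 / 2"]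
    by eventually_elim linarith
qed

end
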